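(* The Bernhard-Jablan Conjecture holds if and only if $u(K)=u_{BJ}^w(K)$ for all knots $K$. Here the Bernhard-Jablan Conjecture is the assertion that every knot $K$ possesses a minimal crossing number diagram $D$ and a crossing in $D$ such that changing the crossing results in a diagram $D'$ for a knot $K'$ with $u(K')<u(K)$; equivalently, that $u(K)=u_{BJ}^s(K)$ for all knots $K$.
   Context: Knots are knots in $S^3$. The crossing number of a knot is the minimum number of crossings over all its diagrams; a minimal crossing number diagram attains this minimum. Changing a crossing means exchanging the over- and under-strands there. The unknotting number $u(K)$ is the minimum number of crossing changes, interspersed with isotopy, required to transform a diagram of $K$ to a diagram of the unknot. For a knot $K$, $\mathsf{BJSet}_K$ is the set of all knots $K'$ represented by a diagram obtained from some minimal crossing number diagram of $K$ by changing a single crossing. The strong Bernhard-Jablan unknotting number of $K$ is $u_{BJ}^s(K) = 1 + \min\{u(K') \mid K' \in \mathsf{BJSet}_K\}$. The weak Bernhard-Jablan unknotting number $u_{BJ}^w(K)$ of any knot $K$ is defined by induction on crossing number. Set $u_{BJ}^w(\text{unknot})=0$, and suppose $u_{BJ}^w$ has been defined for all knots with crossing number $<n$. Let $S$ be the set of knots with crossing number $n$, and for each $K\in S$ let $T_K$ be obtained from $\mathsf{BJSet}_K$ by replacing each knot $K'$ in it with crossing number $<n$ by the number $u_{BJ}^w(K')$. For $\ell=0,1,2,\dots$ in turn do the following: for all $K\in S$ such that $\ell\in T_K$, define $u_{BJ}^w(K)=\ell+1$ and remove $K$ from $S$; then, for all knots $K'$ remaining in $S$, replace every instance of each such removed $K$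 in $T_{K'}$ by the number $\ell+1$. This procedure assigns a value to every knot. *)

theory Defs
  imports "HOL-Analysis.Analysis" "HOL-Library.Extended_Nat"
begin

section \<open>Knots in the 3-sphere\<close>

text \<open>
  Euclidean 3-space is \<open>complex \<times> real\<close>, projected to the plane \<open>complex\<close> by \<^const>\<open>fst\<close>, with
  \<^const>\<open>snd\<close> as height.
\<close>

type_synonym space3 = "complex \<times> real"
type_synonym space4 = "space3 \<times> real"

abbreviation S3 :: "space4 set" where
  "S3 \<equiv> sphere 0 1"

text \<open>Closed curves are \<open>C\<^sup>\<infinity>\<close> and parametrised with period 1; \<open>D n\<close> is the \<open>n\<close>-th derivative.\<close>

definition smooth_loop :: "(real \<Rightarrow> 'a::real_normed_vector) \<Rightarrow> bool" where
  "smooth_loop f \<longleftrightarrow> (\<forall>t. f (t + 1) = f t) \<and>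
     (\<exists>D. D 0 = f \<and> (\<forall>n t. (D n has_vector_derivative D (Suc n) t) (at t)))"

definition immersed_loop :: "(real \<Rightarrow> 'a::real_normed_vector) \<Rightarrow> bool" where
  "immersed_loop f \<longleftrightarrow> smooth_loop f \<and> (\<forall>t. vector_derivative f (at t) \<noteq> 0)"

definition smooth_knot :: "space4 set \<Rightarrow> bool" where
  "smooth_knot A \<longleftrightarrow> A \<subseteq> S3 \<and> (\<exists>f. immersed_loop f \<and> inj_on f {0..<1} \<and> A = range f)"

text \<open>An ambient isotopy is a homotopy through self-homeomorphisms of the sphere.\<close>

definition ambient_isotopic :: "space4 set \<Rightarrow> space4 set \<Rightarrow> bool" where
  "ambient_isotopic A B \<longleftrightarrow>
     (\<exists>f. homotopic_with_canon (\<lambda>f. \<exists>g. homeomorphism S3 S3 f g) S3 S3 id f \<and> f ` A = B)"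

definition same_knot :: "space4 set \<Rightarrow> space4 set \<Rightarrow> bool" where
  "same_knot A B \<longleftrightarrow> smooth_knot A \<and> smooth_knot B \<and> ambient_isotopic A B"

definition unit_circle :: "space4 set" where
  "unit_circle = {((z, 0), 0) | z. norm z = 1}"

lemma smooth_knot_unit_circle: "smooth_knot unit_circle"
proof -
  define c :: complex where "c = 2 * of_real pi * \<i>"
  define D :: "nat \<Rightarrow> real \<Rightarrow> space4"
    where "D = (\<lambda>n t. ((c ^ n * exp (of_real t * c), 0), 0))"
  have c: "c \<noteq> 0"
    by (simp add: c_def)
  have D: "(D n has_vector_derivative D (Suc n) t) (at t)" for n t
  proof -
    have "((\<lambda>t. exp (of_real t * c)) has_vector_derivative c * exp (of_real t * c)) (at t)"
      by (rule has_vector_derivative_real_field) (auto intro!: derivative_eq_intros)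
    from has_vector_derivative_mult_right[OF this, of "c ^ n"]
    have "((\<lambda>t. c ^ n * exp (of_real t * c)) has_vector_derivative c ^ Suc n * exp (of_real t * c)) (at t)"
      by (simp add: mult_ac)
    then show ?thesis
      unfolding D_def by (intro has_vector_derivative_Pair has_vector_derivative_const)
  qed
  have per: "D 0 (t + 1) = D 0 t" for t
    by (simp add: D_def c_def distrib_right exp_add)
  have "vector_derivative (D 0) (at t) = D 1 t" for t
    using D[of 0 t] by (simp add: vector_derivative_at)
  then have nz: "vector_derivative (D 0) (at t) \<noteq> 0" for t
    using c by (simp add: D_def zero_prod_def)
  have e: "exp (of_real t * c) = cis (2 * pi * t)" for t :: real
    by (simp add: c_def cis_conv_exp mult_ac)
  have inj: "inj_on (D 0) {0..<1}"
  proof (rule inj_onI)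
    fix s t :: real
    assume "s \<in> {0..<1}" "t \<in> {0..<1}" "D 0 s = D 0 t"
    then have "cis (2 * pi * s) = cis (2 * pi * t)" and b: "0 \<le> s" "s < 1" "0 \<le> t" "t < 1"
      by (auto simp: D_def e)
    then have "sin (2 * pi * s) = sin (2 * pi * t) \<and> cos (2 * pi * s) = cos (2 * pi * t)"
      by (simp add: complex_eq_iff)
    then obtain n where "2 * pi * s = 2 * pi * t + 2 * pi * real_of_int n"
      using sin_cos_eq_iff by metis
    then have "2 * pi * s = 2 * pi * (t + real_of_int n)"
      by (simp add: distrib_left)
    then have "s = t + real_of_int n"
      by simp
    moreover from this b have "n = 0"
      by linarith
    ultimately show "s = t"
      by simp
  qed
  have "unit_circle = range (D 0)"
  proof
    show "range (D 0) \<subseteq> unit_circle"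
      by (auto simp: D_def e unit_circle_def)
    show "unit_circle \<subseteq> range (D 0)"
    proof
      fix x assume "x \<in> unit_circle"
      then obtain z where z: "x = ((z, 0), 0)" "norm z = 1"
        by (auto simp: unit_circle_def)
      then have "z = cis (2 * pi * (Arg z / (2 * pi)))"
        by (metis cis_Arg divide_self nonzero_mult_div_cancel_left norm_zero one_neq_zero pi_neq_zero
            scaleR_one sgn_div_norm inverse_1 times_divide_eq_right mult_eq_0_iff zero_neq_numeral)
      then have "x = D 0 (Arg z / (2 * pi))"
        using z by (simp add: D_def e)
      then show "x \<in> range (D 0)"
        by blast
    qed
  qed
  moreover have "unit_circle \<subseteq> S3"
    by (auto simp: unit_circle_def norm_Pair)
  moreover have "immersed_loop (D 0)"
    unfolding immersed_loop_def smooth_loop_def using D per nz by blast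
  ultimately show ?thesis
    using inj unfolding smooth_knot_def by blast
qed

lemma ambient_isotopic_refl: "ambient_isotopic A A"
  unfolding ambient_isotopic_def
proof (intro exI conjI)
  show "homotopic_with_canon (\<lambda>f. \<exists>g. homeomorphism S3 S3 f g) S3 S3 id id"
    using homeomorphism_ident[of S3] by (auto simp: id_def)
qed simp

lemma ambient_isotopic_sym:
  assumes "A \<subseteq> S3" "ambient_isotopic A B"
  shows "ambient_isotopic B A"
proof -
  let ?P = "\<lambda>f. \<exists>g. homeomorphism S3 S3 f g"
  obtain f where f: "homotopic_with_canon ?P S3 S3 id f" and B: "f ` A = B"
    using assms(2) unfolding ambient_isotopic_def by blast
  then obtain g where g: "homeomorphism S3 S3 f g"
    using homotopic_with_imp_property by blast
  have P: "?P k" if "?P h" "\<And>x. x \<in> S3 \<Longrightarrow> k x = h x" for h k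
    using that homeomorphism_cong[OF _ refl refl _ refl] by blast
  have cg: "continuous_map (top_of_set S3) (top_of_set S3) g"
    using g by (auto simp: homeomorphism_def)
  have "homotopic_with_canon ?P S3 S3 (id \<circ> g) (f \<circ> g)"
    by (rule homotopic_with_compose_continuous_map_right[OF f cg])
      (use g homeomorphism_compose homeomorphism_symD in blast)
  then have "homotopic_with_canon ?P S3 S3 g id"
  proof (rule homotopic_with_eq)
    show "id x = (f \<circ> g) x" if "x \<in> topspace (top_of_set S3)" for x
      using homeomorphism_apply2[OF g] that by simp
    show "?P h \<longleftrightarrow> ?P k" if "\<And>x. x \<in> topspace (top_of_set S3) \<Longrightarrow> h x = k x" for h k
      using P[of h k] P[of k h] that by auto
  qed simp
  then have "homotopic_with_canon ?P S3 S3 id g"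
    by (rule homotopic_with_symD)
  moreover have "g ` B = A"
    using homeomorphism_apply1[OF g] assms(1) B by (force simp: image_image)
  ultimately show ?thesis
    unfolding ambient_isotopic_def by blast
qed

lemma ambient_isotopic_trans:
  assumes "ambient_isotopic A B" "ambient_isotopic B C"
  shows "ambient_isotopic A C"
proof -
  let ?P = "\<lambda>f. \<exists>g. homeomorphism S3 S3 f g"
  obtain f where f: "homotopic_with_canon ?P S3 S3 id f" and B: "f ` A = B"
    using assms(1) unfolding ambient_isotopic_def by blast
  obtain h where h: "homotopic_with_canon ?P S3 S3 id h" and C: "h ` B = C"
    using assms(2) unfolding ambient_isotopic_def by blast
  obtain g where g: "homeomorphism S3 S3 f g"
    using f homotopic_with_imp_property by blast
  have cf: "continuous_map (top_of_set S3) (top_of_set S3) f"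
    using g by (auto simp: homeomorphism_def)
  have "homotopic_with_canon ?P S3 S3 (id \<circ> f) (h \<circ> f)"
    by (rule homotopic_with_compose_continuous_map_right[OF h cf])
      (use g homeomorphism_compose in blast)
  then have "homotopic_with_canon ?P S3 S3 id (h \<circ> f)"
    using f homotopic_with_trans by fastforce
  then show ?thesis
    using B C unfolding ambient_isotopic_def by (metis image_comp)
qed

quotient_type knot = "space4 set" / partial: same_knot
proof (rule part_equivpI)
  show "\<exists>A. same_knot A A"
    using smooth_knot_unit_circle ambient_isotopic_refl unfolding same_knot_def by blast
  show "symp same_knot"
    using ambient_isotopic_sym by (auto simp: symp_def same_knot_def smooth_knot_def)
  show "transp same_knot"
    using ambient_isotopic_trans unfolding transp_def same_knot_def by blast
qed

lift_definition unknot :: knot is unit_circle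
  using smooth_knot_unit_circle ambient_isotopic_refl by (simp add: same_knot_def)


section \<open>Diagrams\<close>

text \<open>
  A diagram is a closed plane curve together with the set of all parameters in \<open>[0,1)\<close> at which the
  curve runs through a crossing as the over-strand.
\<close>

datatype diagram = Diagram (shadow: "real \<Rightarrow> complex") (overs: "real set")

definition strands :: "diagram \<Rightarrow> complex \<Rightarrow> real set" where
  "strands D p = {t \<in> {0..<1}. shadow D t = p}"

definition crossings :: "diagram \<Rightarrow> complex set" where
  "crossings D = {p. \<exists>s \<in> strands D p. \<exists>t \<in> strands D p. s \<noteq> t}"

text \<open>The quotient of two tangent vectors is non-real iff they are linearly independent.\<close>

definition knot_diagram :: "diagram \<Rightarrow> bool" where
  "knot_diagram D \<longleftrightarrow> immersed_loop (shadow D) \<and> finite (crossings D) \<and>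
     (\<forall>p \<in> crossings D. card (strands D p) = 2 \<and> card (strands D p \<inter> overs D) = 1 \<and>
        (\<forall>s \<in> strands D p. \<forall>t \<in> strands D p. s \<noteq> t \<longrightarrow>
           vector_derivative (shadow D) (at s) / vector_derivative (shadow D) (at t) \<notin> \<real>)) \<and>
     overs D \<subseteq> (\<Union>p \<in> crossings D. strands D p)"

definition change_crossing :: "complex \<Rightarrow> diagram \<Rightarrow> diagram" where
  "change_crossing p D =
     Diagram (shadow D) ((overs D - strands D p) \<union> (strands D p - overs D))"

text \<open>Inverse stereographic projection.\<close>

definition to_S3 :: "space3 \<Rightarrow> space4" where
  "to_S3 x = ((2 / ((norm x)\<^sup>2 + 1)) *\<^sub>R x, ((norm x)\<^sup>2 - 1) / ((norm x)\<^sup>2 + 1))"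

definition height_function :: "diagram \<Rightarrow> (real \<Rightarrow> real) \<Rightarrow> bool" where
  "height_function D h \<longleftrightarrow> smooth_loop h \<and>
     (\<forall>p \<in> crossings D. \<forall>s \<in> strands D p \<inter> overs D. \<forall>t \<in> strands D p - overs D. h t < h s)"

definition represents :: "diagram \<Rightarrow> knot \<Rightarrow> bool" where
  "represents D K \<longleftrightarrow> knot_diagram D \<and>
     (\<exists>h. height_function D h \<and> K = abs_knot (range (\<lambda>t. to_S3 (shadow D t, h t))))"

definition crossing_number :: "knot \<Rightarrow> nat" where
  "crossing_number K = (LEAST n. \<exists>D. represents D K \<and> card (crossings D) = n)"

definition minimal_diagram :: "diagram \<Rightarrow> knot \<Rightarrow> bool" where
  "minimal_diagram D K \<longleftrightarrow> represents D K \<and> card (crossings D) = crossing_number K"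


section \<open>Unknotting numbers\<close>

text \<open>
  Isotopies between successive crossing changes are accounted for by choosing a new diagram of the
  same knot at every step.  The infimum of the empty set is \<open>\<infinity>\<close>; since every knot can be unknotted
  by crossing changes, this value is not attained.
\<close>

definition crossing_change :: "knot \<Rightarrow> knot \<Rightarrow> bool" where
  "crossing_change K K' \<longleftrightarrow>
     (\<exists>D. \<exists>p \<in> crossings D. represents D K \<and> represents (change_crossing p D) K')"

definition unknotting_number :: "knot \<Rightarrow> enat" where
  "unknotting_number K = (INF n \<in> {n. (crossing_change ^^ n) K unknot}. enat n)"

definition BJSet :: "knot \<Rightarrow> knot set" where
  "BJSet K = {K'. \<exists>D. \<exists>p \<in> crossings D. minimal_diagram D K \<and> represents (change_crossing p D) K'}"

text \<open>Only the unknot has empty \<open>BJSet\<close>; its strong Bernhard-Jablan number is taken to be 0.\<close>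

definition strong_BJ_number :: "knot \<Rightarrow> nat" where
  "strong_BJ_number K =
     (if BJSet K = {} then 0 else 1 + (LEAST m. \<exists>K' \<in> BJSet K. unknotting_number K' = enat m))"

text \<open>
  The procedure defining the weak Bernhard-Jablan number works, for a given crossing number, on
  the set \<open>S\<close> of knots awaiting a value, the sets \<open>T K\<close> whose members are knots or numbers, and the
  values \<open>w\<close> defined so far; \<open>BJ_round l\<close> is its step for the number \<open>l\<close>.
\<close>

type_synonym BJ_state = "knot set \<times> (knot \<Rightarrow> (knot + nat) set) \<times> (knot \<rightharpoonup> nat)"

definition put_values :: "(knot \<rightharpoonup> nat) \<Rightarrow> knot + nat \<Rightarrow> knot + nat" where
  "put_values w e = (case e of
     Inl K \<Rightarrow> (case w K of Some m \<Rightarrow> Inr m | None \<Rightarrow> Inl K)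
   | Inr m \<Rightarrow> Inr m)"

text \<open>Here \<open>w\<close> is defined exactly on the knots with crossing number less than \<open>n\<close>.\<close>

definition BJ_start :: "nat \<Rightarrow> (knot \<rightharpoonup> nat) \<Rightarrow> BJ_state" where
  "BJ_start n w =
     ({K. crossing_number K = n}, (\<lambda>K. put_values w ` Inl ` BJSet K), w)"

fun BJ_round :: "nat \<Rightarrow> BJ_state \<Rightarrow> BJ_state" where
  "BJ_round l (S, T, w) =
     (let R = {K \<in> S. Inr l \<in> T K};
          new = (\<lambda>K. if K \<in> R then Some (l + 1) else None)
      in (S - R, (\<lambda>K. put_values new ` T K), w ++ new))"

primrec BJ_rounds :: "nat \<Rightarrow> BJ_state \<Rightarrow> BJ_state" where
  "BJ_rounds 0 st = st"
| "BJ_rounds (Suc l) st = BJ_round l (BJ_rounds l st)"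

definition BJ_result :: "BJ_state \<Rightarrow> (knot \<rightharpoonup> nat)" where
  "BJ_result st K =
     (if \<exists>l m. snd (snd (BJ_rounds l st)) K = Some m
      then Some (THE m. \<exists>l. snd (snd (BJ_rounds l st)) K = Some m) else None)"

text \<open>
  \<open>weak_BJ_upto n\<close> holds the values for the knots with crossing number at most \<open>n\<close>; the unknot is
  the only knot with crossing number 0.
\<close>

primrec weak_BJ_upto :: "nat \<Rightarrow> (knot \<rightharpoonup> nat)" where
  "weak_BJ_upto 0 = [unknot \<mapsto> 0]"
| "weak_BJ_upto (Suc n) = BJ_result (BJ_start (Suc n) (weak_BJ_upto n))"

text \<open>The procedure assigns a value to every knot, so the case \<open>None\<close> does not occur.\<close>

definition weak_BJ_number :: "knot \<Rightarrow> nat" where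
  "weak_BJ_number K = (case weak_BJ_upto (crossing_number K) K of Some m \<Rightarrow> m | None \<Rightarrow> 0)"

text \<open>The unknot has unknotting number 0, so the conjecture concerns nontrivial knots.\<close>

definition Bernhard_Jablan_conjecture :: bool where
  "Bernhard_Jablan_conjecture \<longleftrightarrow>
     (\<forall>K. K \<noteq> unknot \<longrightarrow>
        (\<exists>D. \<exists>p \<in> crossings D. \<exists>K'. minimal_diagram D K \<and>
           represents (change_crossing p D) K' \<and> unknotting_number K' < unknotting_number K))"

end

theory Submission
  imports Defs
begin

text \<open>
  A crossing change lowers the unknotting number by at most one.  Hence under the conjecture every
  nontrivial knot \<open>K\<close> has some \<open>K' \<in> BJSet K\<close> with \<open>u K = u K' + 1\<close>, none with smaller \<open>u K'\<close>, and
  \<open>u K\<close> is finite.  So \<open>u\<close> satisfies the recursions defining both Bernhard-Jablan numbers: in the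
  weak procedure, step \<open>l\<close> settles exactly the knots with \<open>u K = l + 1\<close>.  Conversely, a positive
  strong or weak number \<open>l + 1\<close> of \<open>K\<close> comes from a \<open>K' \<in> BJSet K\<close> with number \<open>l\<close>, so if that
  number agrees with \<open>u\<close>, then \<open>K'\<close> witnesses the conjecture for \<open>K\<close>.
\<close>

section \<open>A diagram of the unknot without crossings\<close>

lemma vector_derivative_eq_0_if_const:
  fixes f :: "real \<Rightarrow> 'a::real_normed_vector"
  assumes "(f has_vector_derivative d) (at t)" "\<And>s. f s = c"
  shows "d = 0"
proof -
  have "f = (\<lambda>_. c)"
    using assms(2) by blast
  then show ?thesis
    using assms(1) vector_derivative_unique_at[OF _ has_vector_derivative_const] by blast
qed

text \<open>The unit circle lies in a copy of the plane, so projecting a parametrisation loses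
  nothing: the other coordinates are constant, their derivatives vanish, and injectivity and nonzero
  velocity pass to the plane curve. This makes the base case of the weak procedure agree with
  \<open>crossing_number\<close>.\<close>

lemma represents_unknot:
  obtains D where "represents D unknot" "crossings D = {}"
proof -
  obtain f where f: "immersed_loop f" "inj_on f {0..<1}" "unit_circle = range f"
    using smooth_knot_unit_circle unfolding smooth_knot_def by blast
  obtain D where per: "\<And>t. f (t + 1) = f t" and D0: "D 0 = f"
    and D: "\<And>n t. (D n has_vector_derivative D (Suc n) t) (at t)"
    using f(1) unfolding immersed_loop_def smooth_loop_def by blast
  define g where "g t = fst (fst (f t))" for t
  have "f t = ((g t, 0), 0) \<and> norm (g t) = 1" for t
  proof -
    have "f t \<in> unit_circle"
      using f(3) by blast
    then show ?thesis
      unfolding unit_circle_def g_def by auto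
  qed
  then have fg: "f t = ((g t, 0), 0)" and norm_g: "norm (g t) = 1" for t
    by blast+
  have Df: "(f has_vector_derivative D 1 t) (at t)" for t
    using D[of 0 t] D0 by simp
  have fst_deriv: "((\<lambda>t. fst (fst (D n t))) has_vector_derivative fst (fst (D (Suc n) t))) (at t)"
    for n t
    using bounded_linear.has_vector_derivative
      [OF bounded_linear_compose[OF bounded_linear_fst bounded_linear_fst] D] .
  have g_deriv: "(g has_vector_derivative fst (fst (D 1 t))) (at t)" for t
    using fst_deriv[of 0 t] by (simp add: D0 g_def[abs_def])
  have "snd (D 1 t) = 0" for t
    using bounded_linear.has_vector_derivative[OF bounded_linear_snd Df]
    by (rule vector_derivative_eq_0_if_const) (simp add: fg)
  moreover have "snd (fst (D 1 t)) = 0" for t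
    using bounded_linear.has_vector_derivative
      [OF bounded_linear_compose[OF bounded_linear_snd bounded_linear_fst] Df]
    by (rule vector_derivative_eq_0_if_const) (simp add: fg)
  moreover have "D 1 t \<noteq> 0" for t
    using f(1) vector_derivative_at[OF Df] unfolding immersed_loop_def by simp
  ultimately have "fst (fst (D 1 t)) \<noteq> 0" for t
    by (metis prod.collapse zero_prod_def)
  then have "vector_derivative g (at t) \<noteq> 0" for t
    using vector_derivative_at[OF g_deriv] by simp
  moreover have "smooth_loop g"
    unfolding smooth_loop_def
    by (rule conjI, simp add: g_def per, rule exI[of _ "\<lambda>n t. fst (fst (D n t))"])
      (use fst_deriv in \<open>simp add: D0 g_def[abs_def]\<close>)
  ultimately have g: "immersed_loop g"
    unfolding immersed_loop_def by blast
  have "inj_on g {0..<1}"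
    using f(2) by (simp add: inj_on_def fg)
  then have none: "crossings (Diagram g {}) = {}"
    by (auto simp: crossings_def strands_def inj_on_def)
  have "smooth_loop (\<lambda>_. 0 :: real)"
    unfolding smooth_loop_def by (auto intro!: exI[of _ "\<lambda>_ _. 0"])
  then have "height_function (Diagram g {}) (\<lambda>_. 0)"
    by (simp add: height_function_def none)
  \<comment> \<open>At norm 1 the scaling factor of \<open>to_S3\<close> is 1 and its last
    coordinate is 0.\<close>
  moreover have "to_S3 (g t, 0) = f t" for t
    by (simp add: to_S3_def norm_Pair norm_g fg)
  then have "unknot = abs_knot (range (\<lambda>t. to_S3 (g t, 0)))"
    by (simp add: unknot_def f(3))
  moreover have "knot_diagram (Diagram g {})"
    by (simp add: knot_diagram_def g none)
  ultimately have "represents (Diagram g {}) unknot"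
    unfolding represents_def by force
  with none that show thesis
    by blast
qed

section \<open>Crossing numbers and \<open>BJSet\<close>\<close>

lemma crossing_number_le: "represents D K \<Longrightarrow> crossing_number K \<le> card (crossings D)"
  unfolding crossing_number_def by (rule Least_le) blast

lemma crossing_number_unknot [simp]: "crossing_number unknot = 0"
  using represents_unknot crossing_number_le by (metis card.empty le_zero_eq)

lemma crossings_change_crossing: "crossings (change_crossing p D) = crossings D"
  by (simp add: change_crossing_def crossings_def strands_def)

lemma BJSetE:
  assumes "K' \<in> BJSet K"
  obtains D p where "p \<in> crossings D" "minimal_diagram D K" "represents (change_crossing p D) K'"
  using assms unfolding BJSet_def by blast

lemma crossing_number_pos_if_BJSet:
  assumes "K' \<in> BJSet K"
  shows "crossing_number K > 0"
proof -
  obtain D p where "p \<in> crossings D" "minimal_diagram D K"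
    using assms by (rule BJSetE)
  \<comment> \<open>Finiteness matters because \<open>card\<close> is 0 on infinite sets.\<close>
  moreover from this have "finite (crossings D)"
    by (simp add: minimal_diagram_def represents_def knot_diagram_def)
  ultimately show ?thesis
    unfolding minimal_diagram_def by (metis card_gt_0_iff empty_iff)
qed

text \<open>The changed diagram has the same shadow, hence as many crossings as a minimal diagram of
  \<open>K\<close>. Thus a stage of the weak procedure never refers to knots of a later
  stage.\<close>

lemma crossing_number_BJSet_le:
  assumes "K' \<in> BJSet K"
  shows "crossing_number K' \<le> crossing_number K"
  using assms crossing_number_le crossings_change_crossing
  by (metis BJSetE minimal_diagram_def)

lemma crossing_change_if_BJSet:
  assumes "K' \<in> BJSet K"
  shows "crossing_change K K'"
  using assms unfolding crossing_change_def minimal_diagram_def BJSet_def by blast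

section \<open>Unknotting numbers and crossing changes\<close>

lemma unknotting_number_le_iff:
  "unknotting_number K \<le> enat m \<longleftrightarrow> (\<exists>n\<le>m. (crossing_change ^^ n) K unknot)"
proof
  assume le: "unknotting_number K \<le> enat m"
  let ?A = "enat ` {n. (crossing_change ^^ n) K unknot}"
  \<comment> \<open>The finite bound excludes the empty set, whose infimum is infinity; by
    well-ordering, a nonempty set attains its infimum.\<close>
  have ne: "?A \<noteq> {}"
  proof
    assume "?A = {}"
    then have "unknotting_number K = \<infinity>"
      unfolding unknotting_number_def by (simp add: top_enat_def)
    with le show False
      by simp
  qed
  then have "Inf ?A \<in> ?A"
    by (meson all_not_in_conv wellorder_InfI)
  with le show "\<exists>n\<le>m. (crossing_change ^^ n) K unknot"
    unfolding unknotting_number_def by auto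
next
  assume "\<exists>n\<le>m. (crossing_change ^^ n) K unknot"
  then obtain n where "n \<le> m" "(crossing_change ^^ n) K unknot"
    by blast
  then show "unknotting_number K \<le> enat m"
    unfolding unknotting_number_def by (intro INF_lower2[of n]) auto
qed

lemma unknotting_number_eq_0_iff: "unknotting_number K = 0 \<longleftrightarrow> K = unknot"
  using unknotting_number_le_iff[of K 0] by (simp add: zero_enat_def[symmetric])

lemma unknotting_number_crossing_change:
  assumes "crossing_change K K'"
  shows "unknotting_number K \<le> eSuc (unknotting_number K')"
proof (cases "unknotting_number K'")
  case (enat m)
  then obtain n where "n \<le> m" "(crossing_change ^^ n) K' unknot"
    using unknotting_number_le_iff[of K' m] by auto
  then have "(crossing_change ^^ Suc n) K unknot"
    using assms by (metis relpowp_Suc_I2)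
  then show ?thesis
    using \<open>n \<le> m\<close> enat unknotting_number_le_iff[of K "Suc m"] Suc_le_mono
    by (metis eSuc_enat)
qed simp

section \<open>The conjecture as a recursion for the unknotting number\<close>

lemma Bernhard_Jablan_conjecture_iff_BJSet:
  "Bernhard_Jablan_conjecture \<longleftrightarrow>
     (\<forall>K. K \<noteq> unknot \<longrightarrow> (\<exists>K' \<in> BJSet K. unknotting_number K' < unknotting_number K))"
  unfolding Bernhard_Jablan_conjecture_def BJSet_def by blast

lemma BJSet_unknot [simp]: "BJSet unknot = {}"
  using crossing_number_pos_if_BJSet by force

text \<open>Finiteness follows from the conjecture itself: a strictly smaller unknotting number is
  finite, and that of \<open>K\<close> exceeds it by at most one. The same two bounds turn the
  strict descent into a descent by exactly one.\<close>

lemma Bernhard_Jablan_conjectureE: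
  assumes Bernhard_Jablan_conjecture
  obtains u where "\<And>K. unknotting_number K = enat (u K)"
    "\<And>K. K \<noteq> unknot \<Longrightarrow> \<exists>K' \<in> BJSet K. u K = Suc (u K')"
    "\<And>K K'. K' \<in> BJSet K \<Longrightarrow> u K \<le> Suc (u K')"
proof -
  have descent: "\<exists>K' \<in> BJSet K. unknotting_number K' < unknotting_number K" if "K \<noteq> unknot" for K
    using assms that unfolding Bernhard_Jablan_conjecture_iff_BJSet by blast
  have upper: "unknotting_number K \<le> eSuc (unknotting_number K')" if "K' \<in> BJSet K" for K K'
    using that by (intro unknotting_number_crossing_change crossing_change_if_BJSet)
  have "unknotting_number K \<noteq> \<infinity>" for K
  proof (cases "K = unknot")
    case True
    then have "unknotting_number K = 0"
      by (simp add: unknotting_number_eq_0_iff)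
    then show ?thesis
      by simp
  next
    case False
    then obtain K' where "K' \<in> BJSet K" "unknotting_number K' < unknotting_number K"
      using descent by blast
    with upper[of K' K] show ?thesis
      using enat_ile by (cases "unknotting_number K'") (auto simp: eSuc_enat)
  qed
  then have "\<forall>K. \<exists>m. unknotting_number K = enat m"
    by simp
  then obtain u where u: "unknotting_number K = enat (u K)" for K
    unfolding choice_iff by blast
  have le: "u K \<le> Suc (u K')" if "K' \<in> BJSet K" for K K'
    using upper[OF that] by (simp add: u eSuc_enat)
  have "\<exists>K' \<in> BJSet K. u K = Suc (u K')" if "K \<noteq> unknot" for K
  proof -
    obtain K' where "K' \<in> BJSet K" "u K' < u K"
      using descent[OF \<open>K \<noteq> unknot\<close>] by (auto simp: u)
    with le[of K' K] show ?thesis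
      by (intro bexI[of _ K']) auto
  qed
  with u le that show thesis
    by blast
qed

section \<open>The strong Bernhard-Jablan number\<close>

theorem Bernhard_Jablan_conjecture_iff_strong:
  "Bernhard_Jablan_conjecture \<longleftrightarrow> (\<forall>K. unknotting_number K = enat (strong_BJ_number K))"
proof
  assume Bernhard_Jablan_conjecture
  then obtain u where u: "\<And>K. unknotting_number K = enat (u K)"
    "\<And>K. K \<noteq> unknot \<Longrightarrow> \<exists>K' \<in> BJSet K. u K = Suc (u K')"
    "\<And>K K'. K' \<in> BJSet K \<Longrightarrow> u K \<le> Suc (u K')"
    by (rule Bernhard_Jablan_conjectureE) blast
  show "\<forall>K. unknotting_number K = enat (strong_BJ_number K)"
  proof
    fix K
    show "unknotting_number K = enat (strong_BJ_number K)"
    proof (cases "K = unknot")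
      case True
      then have "unknotting_number K = 0"
        by (simp add: unknotting_number_eq_0_iff)
      with True show ?thesis
        by (simp add: strong_BJ_number_def zero_enat_def)
    next
      case False
      then obtain K' where K': "K' \<in> BJSet K" "u K = Suc (u K')"
        using u(2) by blast
      \<comment> \<open>No member of \<open>BJSet K\<close> does better than \<open>K'\<close>,
        since \<open>u K = Suc (u K')\<close> is at most one more than the value of any
        member.\<close>
      have "(LEAST m. \<exists>K' \<in> BJSet K. unknotting_number K' = enat m) = u K'"
        using K' u(1,3) by (intro Least_equality) fastforce+
      with K' show ?thesis
        by (auto simp: strong_BJ_number_def u(1))
    qed
  qed
next
  assume eq: "\<forall>K. unknotting_number K = enat (strong_BJ_number K)"
  show Bernhard_Jablan_conjecture
    unfolding Bernhard_Jablan_conjecture_iff_BJSet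
  proof (intro allI impI)
    fix K assume "K \<noteq> unknot"
    \<comment> \<open>The value 0 stands for an empty \<open>BJSet\<close>, so a nontrivial knot
      must have a nonempty one.\<close>
    then have "strong_BJ_number K \<noteq> 0"
      using eq unknotting_number_eq_0_iff by (metis zero_enat_def)
    then have ne: "BJSet K \<noteq> {}"
      and K: "strong_BJ_number K = Suc (LEAST m. \<exists>K' \<in> BJSet K. unknotting_number K' = enat m)"
      by (auto simp: strong_BJ_number_def split: if_splits)
    from ne have "\<exists>m. \<exists>K' \<in> BJSet K. unknotting_number K' = enat m"
      using eq by blast
    then have "\<exists>K' \<in> BJSet K. unknotting_number K' =
        enat (LEAST m. \<exists>K' \<in> BJSet K. unknotting_number K' = enat m)"
      by (rule LeastI_ex)
    moreover have "enat (LEAST m. \<exists>K' \<in> BJSet K. unknotting_number K' = enat m)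
        < unknotting_number K"
      using eq K by simp
    ultimately show "\<exists>K' \<in> BJSet K. unknotting_number K' < unknotting_number K"
      by force
  qed
qed

section \<open>The rounds of the weak procedure\<close>

text \<open>
  The state after \<open>l\<close> rounds is determined by the values assigned so far, which satisfy the following
  recursion.
\<close>

primrec BJ_values :: "nat \<Rightarrow> (knot \<rightharpoonup> nat) \<Rightarrow> nat \<Rightarrow> (knot \<rightharpoonup> nat)" where
  "BJ_values n w 0 = w"
| "BJ_values n w (Suc l) = (\<lambda>K.
     if crossing_number K = n \<and> BJ_values n w l K = None \<and>
       (\<exists>K' \<in> BJSet K. BJ_values n w l K' = Some l)
     then Some (Suc l) else BJ_values n w l K)"

lemma Inr_in_put_values_iff: "Inr l \<in> put_values w ` Inl ` A \<longleftrightarrow> (\<exists>K \<in> A. w K = Some l)"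
  by (force simp: put_values_def split: option.splits)

text \<open>Successive replacement favours \<open>w\<close>, whereas \<open>w ++ w'\<close> favours
  \<open>w'\<close>; disjoint domains reconcile the two.\<close>

lemma put_values_put_values:
  assumes "dom w \<inter> dom w' = {}"
  shows "put_values w' (put_values w e) = put_values (w ++ w') e"
  using assms by (auto simp: put_values_def map_add_def split: sum.splits option.splits)

text \<open>Initially the knots awaiting a value are exactly the unvalued ones with crossing number
  \<open>n\<close>, by the hypothesis on \<open>w\<close>. Each round values only such knots, so all
  replacements so far amount to one replacement in the original \<open>BJSet\<close>.\<close>

lemma BJ_rounds_eq:
  assumes "\<And>K. crossing_number K = n \<Longrightarrow> w K = None"
  shows "BJ_rounds l (BJ_start n w) =
    ({K. crossing_number K = n \<and> BJ_values n w l K = None},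
     (\<lambda>K. put_values (BJ_values n w l) ` Inl ` BJSet K), BJ_values n w l)"
proof (induction l)
  case 0
  show ?case
    using assms by (auto simp: BJ_start_def)
next
  case (Suc l)
  let ?v = "BJ_values n w l"
  let ?S = "{K. crossing_number K = n \<and> ?v K = None}"
  let ?R = "{K \<in> ?S. \<exists>K' \<in> BJSet K. ?v K' = Some l}"
  let ?new = "\<lambda>K. if K \<in> ?R then Some (Suc l) else None"
  have v: "?v ++ ?new = BJ_values n w (Suc l)"
    by (auto simp: map_add_def fun_eq_iff)
  have "dom ?v \<inter> dom ?new = {}"
    by (auto simp: dom_def split: if_splits)
  then have T: "put_values ?new ` put_values ?v ` Inl ` BJSet K
      = put_values (BJ_values n w (Suc l)) ` Inl ` BJSet K" for K
    by (simp only: image_image put_values_put_values v)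
  have R: "{K \<in> ?S. Inr l \<in> put_values ?v ` Inl ` BJSet K} = ?R"
    by (simp only: Inr_in_put_values_iff)
  have S: "?S - ?R = {K. crossing_number K = n \<and> BJ_values n w (Suc l) K = None}"
    by auto
  have "BJ_rounds (Suc l) (BJ_start n w)
      = BJ_round l (?S, (\<lambda>K. put_values ?v ` Inl ` BJSet K), ?v)"
    by (simp only: BJ_rounds.simps Suc.IH)
  also have "\<dots> = (?S - ?R, (\<lambda>K. put_values ?new ` put_values ?v ` Inl ` BJSet K), ?v ++ ?new)"
    unfolding BJ_round.simps R Let_def Suc_eq_plus1 ..
  finally show ?case
    unfolding S T v .
qed

lemma BJ_values_mono:
  assumes "BJ_values n w k K = Some m" "k \<le> l"
  shows "BJ_values n w l K = Some m"
  using assms(2,1) by (induction rule: dec_induct) auto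

lemma BJ_values_eq: "crossing_number K \<noteq> n \<Longrightarrow> BJ_values n w l K = w K"
  by (induction l) auto

text \<open>A value not taken from \<open>w\<close> was assigned in a round \<open>i\<close> as
  \<open>Suc i\<close>, on account of a knot with value \<open>i\<close>; that knot still has this
  value after \<open>l\<close> rounds.\<close>

lemma BJ_values_SomeD:
  assumes "BJ_values n w l K = Some m"
  shows "w K = Some m \<or> (\<exists>K' \<in> BJSet K. \<exists>i. BJ_values n w l K' = Some i \<and> m = Suc i)"
  using assms
proof (induction l)
  case (Suc l)
  have mono: "BJ_values n w l K' = Some i \<Longrightarrow> BJ_values n w (Suc l) K' = Some i" for K' i
    by (rule BJ_values_mono[OF _ le_SucI[OF order_refl]])
  show ?case
  proof (cases "BJ_values n w l K = Some m")
    case True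
    with Suc.IH mono show ?thesis
      by blast
  next
    case False
    then have "m = Suc l" "\<exists>K' \<in> BJSet K. BJ_values n w l K' = Some l"
      using Suc.prems by (auto split: if_splits)
    with mono show ?thesis
      by blast
  qed
qed simp

section \<open>The values assigned by the weak procedure\<close>

lemma BJ_result_eq_Some_iff:
  assumes "\<And>K. crossing_number K = n \<Longrightarrow> w K = None"
  shows "BJ_result (BJ_start n w) K = Some m \<longleftrightarrow> (\<exists>l. BJ_values n w l K = Some m)"
proof -
  have rounds: "snd (snd (BJ_rounds l (BJ_start n w))) = BJ_values n w l" for l
    using BJ_rounds_eq[OF assms] by simp
  \<comment> \<open>Both values persist to the later of the two rounds, so \<open>THE\<close> in
    \<open>BJ_result\<close> is well defined.\<close>
  have unique: "i = j" if "BJ_values n w k K = Some i" "BJ_values n w l K = Some j" for i j k l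
    using BJ_values_mono[OF that(1), of "max k l"] BJ_values_mono[OF that(2), of "max k l"] by simp
  then have "(THE i. \<exists>l. BJ_values n w l K = Some i) = i" if "BJ_values n w k K = Some i" for i k
    using that by blast
  then show ?thesis
    unfolding BJ_result_def rounds by (auto split: if_splits)
qed

text \<open>This supplies the hypothesis of \<open>BJ_result_eq_Some_iff\<close> for the next stage:
  knots with crossing number \<open>Suc n\<close> have no value yet.\<close>

lemma crossing_number_le_if_weak_BJ_upto:
  "weak_BJ_upto n K = Some m \<Longrightarrow> crossing_number K \<le> n"
proof (induction n arbitrary: K m)
  case 0
  then show ?case
    by (auto split: if_splits)
next
  case (Suc n)
  have "weak_BJ_upto n K = None" if "crossing_number K = Suc n" for K
    using Suc.IH[of K] that by (cases "weak_BJ_upto n K") auto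
  from BJ_result_eq_Some_iff[OF this] Suc.prems
  obtain l where "BJ_values (Suc n) (weak_BJ_upto n) l K = Some m"
    by auto
  with BJ_values_eq Suc.IH show ?case
    by (metis le_SucI order_refl)
qed

lemma weak_BJ_upto_Suc_eq_Some_iff:
  "weak_BJ_upto (Suc n) K = Some m \<longleftrightarrow>
     (\<exists>l. BJ_values (Suc n) (weak_BJ_upto n) l K = Some m)"
proof -
  have "weak_BJ_upto n K = None" if "crossing_number K = Suc n" for K
    using crossing_number_le_if_weak_BJ_upto[of n K] that by (cases "weak_BJ_upto n K") auto
  from BJ_result_eq_Some_iff[OF this] show ?thesis
    by simp
qed

text \<open>Every later stage assigns values only to knots whose crossing number is exactly that of
  the stage.\<close>

lemma weak_BJ_upto_crossing_number:
  assumes "crossing_number K \<le> n"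
  shows "weak_BJ_upto n K = weak_BJ_upto (crossing_number K) K"
  using assms
proof (induction rule: dec_induct)
  case (step n)
  then have "weak_BJ_upto (Suc n) K = Some m \<longleftrightarrow> weak_BJ_upto n K = Some m" for m
    by (simp only: weak_BJ_upto_Suc_eq_Some_iff) (simp add: BJ_values_eq)
  then have "weak_BJ_upto (Suc n) K = weak_BJ_upto n K"
    by (metis not_None_eq)
  with step.IH show ?case
    by simp
qed simp

lemma weak_BJ_number_eq_if_weak_BJ_upto:
  assumes "weak_BJ_upto n K = Some m"
  shows "weak_BJ_number K = m"
proof -
  have "weak_BJ_upto (crossing_number K) K = Some m"
    using assms weak_BJ_upto_crossing_number crossing_number_le_if_weak_BJ_upto by metis
  then show ?thesis
    by (simp add: weak_BJ_number_def)
qed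

lemma weak_BJ_upto_SomeD:
  assumes "weak_BJ_upto n K = Some m" "m \<noteq> 0"
  shows "\<exists>K' \<in> BJSet K. m = Suc (weak_BJ_number K')"
  using assms
proof (induction n)
  case 0
  then show ?case
    by (auto split: if_splits)
next
  case (Suc n)
  then obtain l where "BJ_values (Suc n) (weak_BJ_upto n) l K = Some m"
    using weak_BJ_upto_Suc_eq_Some_iff by blast
  from BJ_values_SomeD[OF this] show ?case
  proof
    assume "weak_BJ_upto n K = Some m"
    with Suc show ?thesis
      by blast
  next
    assume "\<exists>K' \<in> BJSet K. \<exists>i. BJ_values (Suc n) (weak_BJ_upto n) l K' = Some i \<and> m = Suc i"
    then show ?thesis
      using weak_BJ_upto_Suc_eq_Some_iff weak_BJ_number_eq_if_weak_BJ_upto by blast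
  qed
qed

lemma weak_BJ_number_nonzeroD:
  assumes "weak_BJ_number K \<noteq> 0"
  shows "\<exists>K' \<in> BJSet K. weak_BJ_number K = Suc (weak_BJ_number K')"
proof -
  \<comment> \<open>The default for \<open>None\<close> is 0, so a nonzero number was really
    assigned by the procedure.\<close>
  have "weak_BJ_upto (crossing_number K) K = Some (weak_BJ_number K)"
    using assms unfolding weak_BJ_number_def by (auto split: option.splits)
  with assms show ?thesis
    using weak_BJ_upto_SomeD by blast
qed

section \<open>The weak number under the conjecture\<close>

text \<open>The procedure computes any \<open>u\<close> that vanishes only at the unknot, descends
  by one somewhere in \<open>BJSet\<close>, and never drops by more. Outer induction is over
  crossing numbers, inner induction over rounds.\<close>

lemma weak_BJ_upto_eq:
  assumes pos: "\<And>K. u K = 0 \<longleftrightarrow> K = unknot"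
    and descent: "\<And>K. K \<noteq> unknot \<Longrightarrow> \<exists>K' \<in> BJSet K. u K = Suc (u K')"
    and upper: "\<And>K K'. K' \<in> BJSet K \<Longrightarrow> u K \<le> Suc (u K')"
    and le: "crossing_number K \<le> n"
  shows "weak_BJ_upto n K = Some (u K)"
  using le
proof (induction n arbitrary: K)
  case 0
  \<comment> \<open>Descent gives every other knot a nonempty \<open>BJSet\<close>, hence a positive
    crossing number.\<close>
  then have "K = unknot"
    using descent[of K] crossing_number_pos_if_BJSet by force
  with pos show ?case
    by simp
next
  case (Suc n)
  let ?v = "BJ_values (Suc n) (weak_BJ_upto n)"
  \<comment> \<open>Invariant of the rounds: besides the knots of earlier stages, exactly those with
    \<open>u\<close> at most \<open>l\<close> are settled, and all values are correct.\<close>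
  have v: "?v l K = (if crossing_number K \<le> n \<or> u K \<le> l then Some (u K) else None)"
    if "crossing_number K \<le> Suc n" for K l
    using that
  proof (induction l arbitrary: K)
    case 0
    have "weak_BJ_upto n K = None" if "\<not> crossing_number K \<le> n"
      using crossing_number_le_if_weak_BJ_upto[of n K] that by (cases "weak_BJ_upto n K") auto
    moreover have "crossing_number K \<le> n" if "u K = 0"
      using that pos by simp
    ultimately show ?case
      using Suc.IH by auto
  next
    case (Suc l)
    show ?case
    proof (cases "crossing_number K = Suc n \<and> \<not> u K \<le> l")
      case True
      have "?v l K' = Some l \<longleftrightarrow> u K' = l" if "K' \<in> BJSet K" for K'
      proof -
        have "crossing_number K' \<le> Suc n"
          using crossing_number_BJSet_le[OF that] True by simp
        then show ?thesis
          by (auto simp: Suc.IH)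
      qed
      \<comment> \<open>As \<open>K\<close> is still unsettled, \<open>u K\<close> exceeds
        \<open>l\<close>, while a member with value \<open>l\<close> bounds it by
        \<open>Suc l\<close>; descent gives the converse.\<close>
      moreover have "(\<exists>K' \<in> BJSet K. u K' = l) \<longleftrightarrow> u K = Suc l"
      proof
        assume "\<exists>K' \<in> BJSet K. u K' = l"
        then show "u K = Suc l"
          using upper True by fastforce
      next
        assume "u K = Suc l"
        then show "\<exists>K' \<in> BJSet K. u K' = l"
          using descent[of K] pos[of K] by auto
      qed
      ultimately have "(\<exists>K' \<in> BJSet K. ?v l K' = Some l) \<longleftrightarrow> u K = Suc l"
        by blast
      with True show ?thesis
        using Suc.IH[of K] by simp
    next
      case False
      then show ?thesis
        using Suc.IH[of K] Suc.prems by auto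
    qed
  qed
  \<comment> \<open>Round count \<open>u K\<close> suffices, so \<open>K\<close> does receive a
    value.\<close>
  have "?v (u K) K = Some (u K)"
    using v[of K "u K"] Suc.prems by simp
  then show ?case
    using weak_BJ_upto_Suc_eq_Some_iff by blast
qed

theorem Bernhard_Jablan_conjecture_iff_weak:
  "Bernhard_Jablan_conjecture \<longleftrightarrow> (\<forall>K. unknotting_number K = enat (weak_BJ_number K))"
proof
  assume Bernhard_Jablan_conjecture
  then obtain u where u: "\<And>K. unknotting_number K = enat (u K)"
    "\<And>K. K \<noteq> unknot \<Longrightarrow> \<exists>K' \<in> BJSet K. u K = Suc (u K')"
    "\<And>K K'. K' \<in> BJSet K \<Longrightarrow> u K \<le> Suc (u K')"
    by (rule Bernhard_Jablan_conjectureE) blast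
  have "u K = 0 \<longleftrightarrow> K = unknot" for K
    using unknotting_number_eq_0_iff[of K] by (simp add: u(1) zero_enat_def)
  from weak_BJ_upto_eq[OF this u(2,3) order_refl] have "weak_BJ_number K = u K" for K
    by (rule weak_BJ_number_eq_if_weak_BJ_upto)
  with u(1) show "\<forall>K. unknotting_number K = enat (weak_BJ_number K)"
    by simp
next
  assume eq: "\<forall>K. unknotting_number K = enat (weak_BJ_number K)"
  show Bernhard_Jablan_conjecture
    unfolding Bernhard_Jablan_conjecture_iff_BJSet
  proof (intro allI impI)
    fix K assume "K \<noteq> unknot"
    then have "weak_BJ_number K \<noteq> 0"
      using eq unknotting_number_eq_0_iff by (metis zero_enat_def)
    from weak_BJ_number_nonzeroD[OF this]
    show "\<exists>K' \<in> BJSet K. unknotting_number K' < unknotting_number K"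
      using eq by auto
  qed
qed

theorem corollary2p2:
  shows "(Bernhard_Jablan_conjecture \<longleftrightarrow>
           (\<forall>K. unknotting_number K = enat (weak_BJ_number K))) \<and>
         (Bernhard_Jablan_conjecture \<longleftrightarrow>
           (\<forall>K. unknotting_number K = enat (strong_BJ_number K)))"
  using Bernhard_Jablan_conjecture_iff_weak Bernhard_Jablan_conjecture_iff_strong by blast

end
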